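(* Let $\mathcal{T},\mathcal{A}\in\Pi_3$ and consider the partial integral equation (PIE) $\mathcal{T}\dot{\mathbf{x}}=\mathcal{A}\mathbf{x}$. The following implications hold between its notions of Lyapunov stability. (1) If the PIE is Lyapunov PIE stable, then it is Lyapunov PIE to PDE stable. (2) If the PIE is Lyapunov PDE stable, then it is Lyapunov PIE to PDE stable. (3) If the PIE is Lyapunov PDE to PIE stable, then it is Lyapunov PIE stable, Lyapunov PDE stable and Lyapunov PIE to PDE stable.
   Context: $L_2$ denotes the real Hilbert space $L_2([0,1];\mathbb{R}^m)$ with inner product $\langle\cdot,\cdot\rangle$ and norm $\|\cdot\|$. A partial integral (PI) operator is a bounded linear operator $\mathcal{P}:L_2\to L_2$ of the form $(\mathcal{P}\mathbf{x})(s)=R_0(s)\mathbf{x}(s)+\int_0^s R_1(s,\theta)\mathbf{x}(\theta)\,d\theta+\int_s^1R_2(s,\theta)\mathbf{x}(\theta)\,d\theta$ with (matrix-valued) $R_0\in L_\infty$ and $R_1,R_2\in L_2$; $\Pi_3$ is the set of all such operators. A solution of $\mathcal{T}\dot{\mathbf{x}}=\mathcal{A}\mathbf{x}$ is a differentiable function $\mathbf{x}:[0,\infty)\to L_2$ with $\mathcal{T}\dot{\mathbf{x}}(t)=\mathcal{A}\mathbf{x}(t)$ for all $t\ge 0$. (When the PIE comes from a classically well-posed PDE, $\mathcal{T}\mathbf{x}(t)$ is the PDE state; this only motivates the terminology.) The PIE is called: - Lyapunov PIE to PDE stable if there is $C>0$ such that every solution satisfies $\|\mathcal{T}\mathbf{x}(t)\|\le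 C\|\mathbf{x}(0)\|$ for all $t\ge0$; - Lyapunov PIE stable if there is $C>0$ such that every solution satisfies $\|\mathbf{x}(t)\|\le C\|\mathbf{x}(0)\|$ for all $t\ge0$; - Lyapunov PDE stable if there is $C>0$ such that every solution satisfies $\|\mathcal{T}\mathbf{x}(t)\|\le C\|\mathcal{T}\mathbf{x}(0)\|$ for all $t\ge0$; - Lyapunov PDE to PIE stable if there is $C>0$ such that every solution satisfies $\|\mathbf{x}(t)\|\le C\|\mathcal{T}\mathbf{x}(0)\|$ for all $t\ge0$. *)

theory Defs
  imports "HOL-Analysis.Analysis"
begin

definition square_integrable :: "'b measure \<Rightarrow> ('b \<Rightarrow> 'a::euclidean_space) \<Rightarrow> bool" where
  "square_integrable M f \<longleftrightarrow>
     f \<in> borel_measurable M \<and> integrable M (\<lambda>x. (norm (f x))\<^sup>2)"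

lemma square_integrable_zero: "square_integrable M (\<lambda>_. 0)"
  by (simp add: square_integrable_def)

lemma square_integrable_scaleR:
  assumes "square_integrable M f"
  shows "square_integrable M (\<lambda>x. c *\<^sub>R f x)"
  using assms by (auto simp: square_integrable_def power_mult_distrib)

lemma square_integrable_uminus:
  assumes "square_integrable M f"
  shows "square_integrable M (\<lambda>x. - f x)"
  using square_integrable_scaleR[OF assms, of "-1"] by simp

lemma square_integrable_add:
  assumes "square_integrable M f" "square_integrable M g"
  shows "square_integrable M (\<lambda>x. f x + g x)"
proof -
  have m: "f \<in> borel_measurable M" "g \<in> borel_measurable M"
    using assms by (auto simp: square_integrable_def)
  have "integrable M (\<lambda>x. (norm (f x + g x))\<^sup>2)"
  proof (rule Bochner_Integration.integrable_bound)
    show "integrable M (\<lambda>x. 2 * (norm (f x))\<^sup>2 + 2 * (norm (g x))\<^sup>2)"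
      using assms by (auto simp: square_integrable_def)
    show "(\<lambda>x. (norm (f x + g x))\<^sup>2) \<in> borel_measurable M"
      using m by measurable
    have "(norm (f x + g x))\<^sup>2 \<le> 2 * (norm (f x))\<^sup>2 + 2 * (norm (g x))\<^sup>2" for x
    proof -
      have "(norm (f x + g x))\<^sup>2 \<le> (norm (f x) + norm (g x))\<^sup>2"
        by (intro power_mono norm_triangle_ineq) simp
      also have "\<dots> \<le> 2 * (norm (f x))\<^sup>2 + 2 * (norm (g x))\<^sup>2"
        using sum_squares_bound[of "norm (f x)" "norm (g x)"]
        by (simp add: power2_sum)
      finally show ?thesis .
    qed
    then show "AE x in M. norm ((norm (f x + g x))\<^sup>2)
                 \<le> norm (2 * (norm (f x))\<^sup>2 + 2 * (norm (g x))\<^sup>2)"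
      by simp
  qed
  then show ?thesis using m by (simp add: square_integrable_def)
qed

lemma square_integrable_diff:
  assumes "square_integrable M f" "square_integrable M g"
  shows "square_integrable M (\<lambda>x. f x - g x)"
  using square_integrable_add[OF assms(1) square_integrable_uminus[OF assms(2)]] by simp

lemma integrable_inner_square_integrable:
  assumes "square_integrable M f" "square_integrable M g"
  shows "integrable M (\<lambda>x. f x \<bullet> g x)"
proof (rule Bochner_Integration.integrable_bound)
  show "integrable M (\<lambda>x. (norm (f x))\<^sup>2 + (norm (g x))\<^sup>2)"
    using assms by (auto simp: square_integrable_def)
  show "(\<lambda>x. f x \<bullet> g x) \<in> borel_measurable M"
    using assms by (auto simp: square_integrable_def)
  have "\<bar>f x \<bullet> g x\<bar> \<le> (norm (f x))\<^sup>2 + (norm (g x))\<^sup>2" for x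
  proof -
    have "\<bar>f x \<bullet> g x\<bar> \<le> norm (f x) * norm (g x)"
      by (rule Cauchy_Schwarz_ineq2)
    moreover have "0 \<le> norm (f x) * norm (g x)" by simp
    ultimately show ?thesis
      using sum_squares_bound[of "norm (f x)" "norm (g x)"] by linarith
  qed
  then show "AE x in M. norm (f x \<bullet> g x) \<le> norm ((norm (f x))\<^sup>2 + (norm (g x))\<^sup>2)"
    by simp
qed

abbreviation unit_interval :: "real measure" where
  "unit_interval \<equiv> lebesgue_on {0..1}"

text \<open>The space \<open>L\<^sub>2([0,1]; \<real>\<^sup>m)\<close>, with \<open>m = CARD('m)\<close>: square-integrable functions
  modulo equality almost everywhere on \<open>[0,1]\<close>.\<close>

definition L2_rel :: "(real \<Rightarrow> real^'m) \<Rightarrow> (real \<Rightarrow> real^'m) \<Rightarrow> bool" where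
  "L2_rel f g \<longleftrightarrow> square_integrable unit_interval f \<and> square_integrable unit_interval g
     \<and> (AE s in unit_interval. f s = g s)"

lemma part_equivp_L2_rel: "part_equivp L2_rel"
proof (rule part_equivpI)
  show "\<exists>f. L2_rel f f"
    using square_integrable_zero by (auto simp: L2_rel_def)
  show "symp L2_rel"
    by (rule sympI) (auto simp: L2_rel_def elim: AE_mp)
  show "transp L2_rel"
  proof (rule transpI)
    fix f g h :: "real \<Rightarrow> real^'m"
    assume "L2_rel f g" "L2_rel g h"
    moreover from this have "AE s in unit_interval. f s = h s"
      unfolding L2_rel_def by (elim conjE, elim AE_mp) auto
    ultimately show "L2_rel f h" by (auto simp: L2_rel_def)
  qed
qed

quotient_type 'm L2 = "real \<Rightarrow> real^'m::finite" / partial: L2_rel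
  by (rule part_equivp_L2_rel)

instantiation L2 :: (finite) real_inner
begin

lift_definition zero_L2 :: "'a L2" is "\<lambda>_. 0"
  by (simp add: L2_rel_def square_integrable_zero)

lift_definition plus_L2 :: "'a L2 \<Rightarrow> 'a L2 \<Rightarrow> 'a L2" is "\<lambda>f g s. f s + g s"
  by (auto simp: L2_rel_def square_integrable_add)

lift_definition minus_L2 :: "'a L2 \<Rightarrow> 'a L2 \<Rightarrow> 'a L2" is "\<lambda>f g s. f s - g s"
  by (auto simp: L2_rel_def square_integrable_diff)

lift_definition uminus_L2 :: "'a L2 \<Rightarrow> 'a L2" is "\<lambda>f s. - f s"
  by (auto simp: L2_rel_def square_integrable_uminus)

lift_definition scaleR_L2 :: "real \<Rightarrow> 'a L2 \<Rightarrow> 'a L2" is "\<lambda>c f s. c *\<^sub>R f s"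
  by (auto simp: L2_rel_def square_integrable_scaleR)

lift_definition inner_L2 :: "'a L2 \<Rightarrow> 'a L2 \<Rightarrow> real" is
  "\<lambda>f g. \<integral>s. f s \<bullet> g s \<partial>unit_interval"
  by (rule integral_cong_AE) (auto simp: L2_rel_def square_integrable_def)

definition norm_L2 :: "'a L2 \<Rightarrow> real" where
  "norm_L2 x = sqrt (x \<bullet> x)"

definition dist_L2 :: "'a L2 \<Rightarrow> 'a L2 \<Rightarrow> real" where
  "dist_L2 x y = norm (x - y)"

definition sgn_L2 :: "'a L2 \<Rightarrow> 'a L2" where
  "sgn_L2 x = inverse (norm x) *\<^sub>R x"

definition uniformity_L2 :: "('a L2 \<times> 'a L2) filter" where
  "uniformity_L2 = (INF e\<in>{0<..}. principal {(x, y). dist x y < e})"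

definition open_L2 :: "'a L2 set \<Rightarrow> bool" where
  "open_L2 U \<longleftrightarrow> (\<forall>x\<in>U. eventually (\<lambda>(x', y). x' = x \<longrightarrow> y \<in> U) uniformity)"

instance
proof
  fix x y z :: "'a L2" and a b :: real and U :: "'a L2 set"
  show "dist x y = norm (x - y)" by (rule dist_L2_def)
  show "sgn x = inverse (norm x) *\<^sub>R x" by (rule sgn_L2_def)
  show "uniformity = (INF e\<in>{0<..}. principal {(x :: 'a L2, y). dist x y < e})"
    by (rule uniformity_L2_def)
  show "open U \<longleftrightarrow> (\<forall>x\<in>U. eventually (\<lambda>(x', y). x' = x \<longrightarrow> y \<in> U) uniformity)"
    by (rule open_L2_def)
  show "norm x = sqrt (x \<bullet> x)" by (rule norm_L2_def)
  show "x + y + z = x + (y + z)"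
    by transfer (auto simp: L2_rel_def add.assoc intro!: square_integrable_add)
  show "x + y = y + x"
    by transfer (auto simp: L2_rel_def add.commute intro!: square_integrable_add)
  show "0 + x = x"
    by transfer (auto simp: L2_rel_def)
  show "- x + x = 0"
    by transfer (auto simp: L2_rel_def square_integrable_zero)
  show "x - y = x + - y"
    by transfer (auto simp: L2_rel_def square_integrable_diff)
  show "a *\<^sub>R (x + y) = a *\<^sub>R x + a *\<^sub>R y"
    by transfer (auto simp: L2_rel_def scaleR_add_right
        intro!: square_integrable_add square_integrable_scaleR)
  show "(a + b) *\<^sub>R x = a *\<^sub>R x + b *\<^sub>R x"
    by transfer (auto simp: L2_rel_def scaleR_add_left
        intro!: square_integrable_add square_integrable_scaleR)
  show "a *\<^sub>R b *\<^sub>R x = (a * b) *\<^sub>R x"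
    by transfer (auto simp: L2_rel_def intro!: square_integrable_scaleR)
  show "1 *\<^sub>R x = x"
    by transfer (auto simp: L2_rel_def)
  show "x \<bullet> y = y \<bullet> x"
    by transfer (simp add: inner_commute)
  show "(x + y) \<bullet> z = x \<bullet> z + y \<bullet> z"
    by transfer (simp add: inner_add_left L2_rel_def integrable_inner_square_integrable)
  show "a *\<^sub>R x \<bullet> y = a * (x \<bullet> y)"
    by transfer simp
  show "0 \<le> x \<bullet> x"
    by transfer simp
  show "x \<bullet> x = 0 \<longleftrightarrow> x = 0"
  proof transfer
    fix f :: "real \<Rightarrow> real^'a"
    assume "L2_rel f f"
    then have f: "square_integrable unit_interval f" by (simp add: L2_rel_def)
    have "(\<integral>s. f s \<bullet> f s \<partial>unit_interval) = 0 \<longleftrightarrow> (AE s in unit_interval. f s \<bullet> f s = 0)"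
      by (rule integral_nonneg_eq_0_iff_AE)
        (auto intro: integrable_inner_square_integrable f)
    then show "(\<integral>s. f s \<bullet> f s \<partial>unit_interval) = 0 \<longleftrightarrow> L2_rel f (\<lambda>_. 0)"
      using f by (simp add: L2_rel_def square_integrable_zero)
  qed
qed

end

text \<open>The operators of the class \<open>\<Pi>\<^sub>3\<close>. The function \<open>rep_L2\<close> picks an arbitrary
  representative; its choice does not matter, since the formula is required for almost every
  \<open>s\<close> and changing \<open>x\<close> on a null set does not affect the integrals. For almost every \<open>s\<close> the
  kernels \<open>R\<^sub>1(s,\<cdot>)\<close> and \<open>R\<^sub>2(s,\<cdot>)\<close> are square integrable, so the integrals exist.\<close>

definition PI_operators :: "('m::finite L2 \<Rightarrow> 'm L2) set" where
  "PI_operators = {P. bounded_linear P \<and>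
     (\<exists>(R0 :: real \<Rightarrow> real^'m^'m) (R1 :: real \<Rightarrow> real \<Rightarrow> real^'m^'m) (R2 :: real \<Rightarrow> real \<Rightarrow> real^'m^'m).
        R0 \<in> borel_measurable unit_interval \<and>
        (\<exists>C. AE s in unit_interval. norm (R0 s) \<le> C) \<and>
        square_integrable (lebesgue_on ({0..1} \<times> {0..1})) (\<lambda>(s, \<theta>). R1 s \<theta>) \<and>
        square_integrable (lebesgue_on ({0..1} \<times> {0..1})) (\<lambda>(s, \<theta>). R2 s \<theta>) \<and>
        (\<forall>x. AE s in unit_interval.
           rep_L2 (P x) s = R0 s *v rep_L2 x s
             + (LINT \<theta>:{0..s}|lebesgue. R1 s \<theta> *v rep_L2 x \<theta>)
             + (LINT \<theta>:{s..1}|lebesgue. R2 s \<theta> *v rep_L2 x \<theta>)))}"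

text \<open>Only the values \<open>x t\<close> with \<open>t \<ge> 0\<close> matter; at \<open>t = 0\<close> the derivative is one-sided.\<close>

definition PIE_solution ::
  "('m::finite L2 \<Rightarrow> 'm L2) \<Rightarrow> ('m L2 \<Rightarrow> 'm L2) \<Rightarrow> (real \<Rightarrow> 'm L2) \<Rightarrow> bool" where
  "PIE_solution T A x \<longleftrightarrow>
     (\<forall>t\<ge>0. \<exists>x'. (x has_vector_derivative x') (at t within {0..}) \<and> T x' = A (x t))"

definition Lyapunov_PIE_to_PDE_stable ::
  "('m::finite L2 \<Rightarrow> 'm L2) \<Rightarrow> ('m L2 \<Rightarrow> 'm L2) \<Rightarrow> bool" where
  "Lyapunov_PIE_to_PDE_stable T A \<longleftrightarrow>
     (\<exists>C>0. \<forall>x. PIE_solution T A x \<longrightarrow> (\<forall>t\<ge>0. norm (T (x t)) \<le> C * norm (x 0)))"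

definition Lyapunov_PIE_stable ::
  "('m::finite L2 \<Rightarrow> 'm L2) \<Rightarrow> ('m L2 \<Rightarrow> 'm L2) \<Rightarrow> bool" where
  "Lyapunov_PIE_stable T A \<longleftrightarrow>
     (\<exists>C>0. \<forall>x. PIE_solution T A x \<longrightarrow> (\<forall>t\<ge>0. norm (x t) \<le> C * norm (x 0)))"

definition Lyapunov_PDE_stable ::
  "('m::finite L2 \<Rightarrow> 'm L2) \<Rightarrow> ('m L2 \<Rightarrow> 'm L2) \<Rightarrow> bool" where
  "Lyapunov_PDE_stable T A \<longleftrightarrow>
     (\<exists>C>0. \<forall>x. PIE_solution T A x \<longrightarrow> (\<forall>t\<ge>0. norm (T (x t)) \<le> C * norm (T (x 0))))"

definition Lyapunov_PDE_to_PIE_stable ::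
  "('m::finite L2 \<Rightarrow> 'm L2) \<Rightarrow> ('m L2 \<Rightarrow> 'm L2) \<Rightarrow> bool" where
  "Lyapunov_PDE_to_PIE_stable T A \<longleftrightarrow>
     (\<exists>C>0. \<forall>x. PIE_solution T A x \<longrightarrow> (\<forall>t\<ge>0. norm (x t) \<le> C * norm (T (x 0))))"

end

theory Submission
  imports Defs
begin

text \<open>Each notion of stability bounds an output size at time \<open>t\<close> by an input size at time \<open>0\<close>,
  where a state is measured either by \<open>\<parallel>x\<parallel>\<close> or by \<open>\<parallel>T x\<parallel>\<close>. An operator of the class \<open>\<Pi>\<^sub>3\<close> is
  bounded, so \<open>\<parallel>T x\<parallel> \<le> K \<parallel>x\<parallel>\<close>: measuring the output through \<open>T\<close>, or measuring the input without
  \<open>T\<close>, weakens a stability notion at the cost of a factor \<open>K\<close>. All the implications are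
  combinations of these two weakenings, which \<open>stability_estimate_mono\<close> performs at once.
  The factor \<open>K\<close> depends on \<open>T\<close> alone, so the constant stays uniform over all solutions.\<close>

lemma stability_estimate_mono:
  fixes out out' :: "'a \<Rightarrow> real \<Rightarrow> real" and inp inp' :: "'a \<Rightarrow> real"
  assumes "\<exists>C>0. \<forall>x. S x \<longrightarrow> (\<forall>t\<ge>0. out x t \<le> C * inp x)"
    and "K > 0" and out': "\<And>x t. out' x t \<le> K * out x t"
    and "L > 0" and inp': "\<And>x. inp x \<le> L * inp' x"
  shows "\<exists>C>0. \<forall>x. S x \<longrightarrow> (\<forall>t\<ge>0. out' x t \<le> C * inp' x)"
proof -
  from assms(1) obtain C where "C > 0" and C: "\<And>x t. S x \<Longrightarrow> t \<ge> 0 \<Longrightarrow> out x t \<le> C * inp x"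
    by blast
  have "out' x t \<le> (K * C * L) * inp' x" if "S x" "t \<ge> 0" for x t
  proof -
    have "out' x t \<le> K * out x t" by (rule out')
    also have "\<dots> \<le> K * (C * inp x)"
      using C[OF that] \<open>K > 0\<close> by (intro mult_left_mono) auto
    also have "\<dots> \<le> K * (C * (L * inp' x))"
      using inp' \<open>K > 0\<close> \<open>C > 0\<close> by (intro mult_left_mono) auto
    finally show ?thesis by (simp add: mult.assoc)
  qed
  moreover have "K * C * L > 0" using \<open>K > 0\<close> \<open>C > 0\<close> \<open>L > 0\<close> by simp
  ultimately show ?thesis by blast
qed

theorem lemma2:
  fixes T A :: "'m::finite L2 \<Rightarrow> 'm L2"
  assumes "T \<in> PI_operators" and "A \<in> PI_operators"
  shows "(Lyapunov_PIE_stable T A \<longrightarrow> Lyapunov_PIE_to_PDE_stable T A) \<and>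
         (Lyapunov_PDE_stable T A \<longrightarrow> Lyapunov_PIE_to_PDE_stable T A) \<and>
         (Lyapunov_PDE_to_PIE_stable T A \<longrightarrow>
            Lyapunov_PIE_stable T A \<and> Lyapunov_PDE_stable T A \<and> Lyapunov_PIE_to_PDE_stable T A)"
proof -
  have "bounded_linear T" using assms(1) by (simp add: PI_operators_def)
  then obtain K where "K > 0" and K: "\<And>y. norm (T y) \<le> K * norm y"
    using bounded_linear.pos_bounded by (metis mult.commute)
  note unfold_stability = Lyapunov_PIE_to_PDE_stable_def Lyapunov_PIE_stable_def
    Lyapunov_PDE_stable_def Lyapunov_PDE_to_PIE_stable_def
  have PIE: "Lyapunov_PIE_to_PDE_stable T A" if "Lyapunov_PIE_stable T A"
    using that unfolding unfold_stability
    by (rule stability_estimate_mono[where K = K and L = 1]) (use \<open>K > 0\<close> K in auto)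
  have PDE: "Lyapunov_PIE_to_PDE_stable T A" if "Lyapunov_PDE_stable T A"
    using that unfolding unfold_stability
    by (rule stability_estimate_mono[where K = 1 and L = K]) (use \<open>K > 0\<close> K in auto)
  have to_PIE: "Lyapunov_PIE_stable T A" if "Lyapunov_PDE_to_PIE_stable T A"
    using that unfolding unfold_stability
    by (rule stability_estimate_mono[where K = 1 and L = K]) (use \<open>K > 0\<close> K in auto)
  have to_PDE: "Lyapunov_PDE_stable T A" if "Lyapunov_PDE_to_PIE_stable T A"
    using that unfolding unfold_stability
    by (rule stability_estimate_mono[where K = K and L = 1]) (use \<open>K > 0\<close> K in auto)
  show ?thesis using PIE PDE to_PIE to_PDE by blast
qed

end
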